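(* Let $(\Omega,\mathcal{A},\mathbb{P},\mathbb{F})$ be a filtered probability space, $n_0\in\mathbb{N}_0$, and let $X=(X_n)_{n\geq n_0}$ be a martingale with values in a separable Hilbert space $(H,\langle\cdot,\cdot\rangle)$ with norm $\|\cdot\|$, which satisfies $\sup_{n\geq n_0}\mathbb{E}[\|X_n\|^2]<\infty$. Then $X$ converges a.s. and in $L^2(\Omega;H)$ to a random vector $X_\infty$ in $L^2(\Omega;H)$. In addition, for any positive, nonincreasing sequence $\epsilon=(\varepsilon_n)_{n\geq n_0}$ it follows that $$\mathbb{P}(\|X_n-X_\infty\|>\varepsilon_n)\leq \varepsilon_n^{-2}\cdot\mathbb{E}[\|X_n-X_\infty\|^2]=\varepsilon_n^{-2}\cdot\sum_{m=n+1}^\infty\mathbb{E}[\|\Delta X_m\|^2]=\varepsilon_n^{-2}\cdot\pi_n,\qquad n\geq n_0,$$ where $\Delta X_n:=X_n-X_{n-1}$ and $\pi_n=\sum_{m=n+1}^\infty\mathbb{E}[\|\Delta X_m\|^2]$ for $n\geq n_0$. Moreover, for all positive, nonincreasing sequences $\epsilon=(\varepsilon_n)_{n\geq n_0}$ and positive, nondecreasing sequences $a=(a_n)_{n\geq n_0}$ such that $$K(a,\epsilon):=\sum_{n=n_0}^\infty a_n\sum_{m=n}^\infty\varepsilon_m^{-2}\cdot\pi_m<\infty,$$ it follows that $$\limsup_{n\to\infty}\|X_n-X_\infty\|\cdot\varepsilon_n^{-1}\leq 1\qquad\mathbb{P}\text{-a.s.}$$ and $$\mathbb{E}[\mathcal{S}_{a,n_0}(\mathcal{O}_{\epsilon,n_0})]\leq\mathbb{E}[\mathcal{S}_{a,n_0}(\mathbf{m}_{\epsilon,n_0})]\leq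 K(a,\epsilon),$$ with $\mathcal{O}_{\epsilon,n_0}$, $\mathbf{m}_{\epsilon,n_0}$, $\mathcal{S}_{a,n_0}$ as defined in the context.
   Context: $\mathbb{N}=\{1,2,\dots\}$, $\mathbb{N}_0=\{0,1,2,\dots\}$. $\mathbf{1}$ denotes an indicator function. $\mathcal{O}_{\epsilon,n_0}:=\sum_{n=n_0}^\infty\mathbf{1}\{\|X_n-X_\infty\|>\varepsilon_n\}$. $\mathbf{m}_{\epsilon,n_0}:=\max\{n\geq n_0:\|X_n-X_\infty\|>\varepsilon_n\}$. $\mathcal{S}_{a,n_0}(N):=\sum_{n=0}^{N-1}a_{n_0+n}$ for $N\in\mathbb{N}$, and $\mathcal{S}_{a,n_0}(0):=0$.
   Formalization: The final chain fails as written unless n_0=1; it is proved for all n_0 with m replaced by m-n_0+1 (0 if there is no deviation). For the literal m, E[S(O)]<=E[S(m)] is proved for n_0>=1 and E[S(m)]<=K for n_0<=1. *)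

theory Defs
  imports "HOL-Probability.Probability"
begin

text \<open>
  The library only has conditional expectations of real functions.  \<open>g\<close> is a version of the
  conditional expectation of the Bochner integrable, vector-valued \<open>f\<close> given \<open>F\<close>.
\<close>

definition has_cond_exp ::
    "'a measure \<Rightarrow> 'a measure \<Rightarrow> ('a \<Rightarrow> 'b::{banach, second_countable_topology}) \<Rightarrow> ('a \<Rightarrow> 'b) \<Rightarrow> bool"
  where "has_cond_exp M F f g \<longleftrightarrow>
    integrable M f \<and> integrable M g \<and> g \<in> borel_measurable F \<and>
    (\<forall>A\<in>sets F. (LINT \<omega>:A|M. f \<omega>) = (LINT \<omega>:A|M. g \<omega>))"

definition martingale_from ::
    "nat \<Rightarrow> 'a measure \<Rightarrow> (nat \<Rightarrow> 'a measure) \<Rightarrow>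
     (nat \<Rightarrow> 'a \<Rightarrow> 'b::{banach, second_countable_topology}) \<Rightarrow> bool"
  where "martingale_from n0 M F X \<longleftrightarrow>
    (\<forall>n\<ge>n0. X n \<in> borel_measurable (F n) \<and> integrable M (X n)) \<and>
    (\<forall>n\<ge>n0. \<forall>m\<ge>n. has_cond_exp M (F n) (X m) (X n))"

text \<open>Moments, tail sums and \<open>K\<close> are \<open>ennreal\<close>-valued, so that finiteness is a genuine condition.\<close>

definition sq_moment :: "'a measure \<Rightarrow> ('a \<Rightarrow> 'b::real_normed_vector) \<Rightarrow> ennreal"
  where "sq_moment M Y = (\<integral>\<^sup>+\<omega>. ennreal ((norm (Y \<omega>))\<^sup>2) \<partial>M)"

definition incr :: "(nat \<Rightarrow> 'a \<Rightarrow> 'b::real_normed_vector) \<Rightarrow> nat \<Rightarrow> 'a \<Rightarrow> 'b"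
  where "incr X n \<omega> = X n \<omega> - X (n - 1) \<omega>"

text \<open>The sum over \<open>m \<ge> n + 1\<close>, re-indexed by \<open>m = n + 1 + k\<close>.\<close>

definition incr_tail :: "'a measure \<Rightarrow> (nat \<Rightarrow> 'a \<Rightarrow> 'b::real_normed_vector) \<Rightarrow> nat \<Rightarrow> ennreal"
  where "incr_tail M X n = (\<Sum>k. sq_moment M (incr X (n + 1 + k)))"

definition K_const ::
    "nat \<Rightarrow> (nat \<Rightarrow> real) \<Rightarrow> (nat \<Rightarrow> real) \<Rightarrow> (nat \<Rightarrow> ennreal) \<Rightarrow> ennreal"
  where "K_const n0 a \<epsilon> \<pi> =
    (\<Sum>i. ennreal (a (n0 + i)) * (\<Sum>j. ennreal (1 / (\<epsilon> (n0 + i + j))\<^sup>2) * \<pi> (n0 + i + j)))"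

text \<open>
  In the next three definitions \<open>d n\<close> stands for \<open>norm (X n \<omega> - X\<^sub>\<infinity> \<omega>)\<close> at a fixed \<open>\<omega>\<close>.
  The values are extended naturals, since there may be infinitely many deviations.
\<close>

definition overlap_count :: "nat \<Rightarrow> (nat \<Rightarrow> real) \<Rightarrow> (nat \<Rightarrow> real) \<Rightarrow> enat"
  where "overlap_count n0 \<epsilon> d = (\<Sum>k. if d (n0 + k) > \<epsilon> (n0 + k) then 1 else 0)"

text \<open>The supremum is the maximum if there are finitely many deviations, and \<open>0\<close> if there is none.\<close>

definition last_dev :: "nat \<Rightarrow> (nat \<Rightarrow> real) \<Rightarrow> (nat \<Rightarrow> real) \<Rightarrow> enat"
  where "last_dev n0 \<epsilon> d = (SUP n\<in>{n. n \<ge> n0 \<and> d n > \<epsilon> n}. enat n)"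

text \<open>
  The same last deviation, but given by its rank among the indices \<open>n0, n0 + 1, \<dots>\<close>, that is
  shifted by \<open>1 - n0\<close>; if there is no deviation it is \<open>0\<close>.  For \<open>n0 = 1\<close> it coincides with
  \<open>last_dev\<close>.  In general this is the argument for which \<open>S_sum a n0\<close> adds up exactly
  \<open>a n0, \<dots>, a n\<close> when the last deviation occurs at index \<open>n\<close>.  For \<open>n0 = 0\<close>, unlike \<open>last_dev\<close>,
  it distinguishes a single deviation at index \<open>0\<close> from no deviation.
\<close>

definition last_dev_rank :: "nat \<Rightarrow> (nat \<Rightarrow> real) \<Rightarrow> (nat \<Rightarrow> real) \<Rightarrow> enat"
  where "last_dev_rank n0 \<epsilon> d = (SUP n\<in>{n. n \<ge> n0 \<and> d n > \<epsilon> n}. enat (n - n0 + 1))"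

definition S_sum :: "(nat \<Rightarrow> real) \<Rightarrow> nat \<Rightarrow> enat \<Rightarrow> ennreal"
  where "S_sum a n0 N =
    (case N of enat k \<Rightarrow> (\<Sum>n<k. ennreal (a (n0 + n))) | \<infinity> \<Rightarrow> (\<Sum>n. ennreal (a (n0 + n))))"

end

theory Submission
  imports Defs
begin

text \<open>
  For \<open>n \<le> m\<close> the increment \<open>X m - X n\<close> is orthogonal in \<open>L\<^sup>2\<close> to every square integrable
  \<open>F n\<close>-measurable vector, so \<open>E \<parallel>X m - X n\<parallel>\<^sup>2 = E \<parallel>X m\<parallel>\<^sup>2 - E \<parallel>X n\<parallel>\<^sup>2\<close>, which is small uniformly
  in \<open>m\<close>.  Kolmogorov's maximal inequality upgrades this to almost sure convergence, and Fatou's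
  lemma to convergence in \<open>L\<^sup>2\<close>; telescoping identifies the squared \<open>L\<^sup>2\<close> distance to the limit
  with \<open>incr_tail\<close>.  Finally, \<open>a (n0 + i)\<close> contributes to \<open>S_sum\<close> at the rank of the last deviation
  iff some deviation occurs at an index \<open>\<ge> n0 + i\<close>; a union bound and Chebyshev's inequality then
  give \<open>K_const\<close>.
\<close>

subsection \<open>Square integrable vectors and conditional expectations\<close>

lemma integrable_mult_square_integrable:
  fixes f g :: "'a \<Rightarrow> real"
  assumes [measurable]: "f \<in> borel_measurable M" "g \<in> borel_measurable M"
    and "integrable M (\<lambda>x. (f x)\<^sup>2)" "integrable M (\<lambda>x. (g x)\<^sup>2)"
  shows "integrable M (\<lambda>x. f x * g x)"
proof (rule Bochner_Integration.integrable_bound)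
  show "integrable M (\<lambda>x. (f x)\<^sup>2 + (g x)\<^sup>2)"
    using assms by auto
  have "\<bar>u * w\<bar> \<le> u\<^sup>2 + w\<^sup>2" for u w :: real
  proof -
    have "0 \<le> \<bar>u\<bar> * \<bar>w\<bar>" and "2 * \<bar>u\<bar> * \<bar>w\<bar> \<le> u\<^sup>2 + w\<^sup>2"
      using sum_squares_bound[of "\<bar>u\<bar>" "\<bar>w\<bar>"] by simp_all
    then show ?thesis
      unfolding abs_mult by linarith
  qed
  then show "AE x in M. norm (f x * g x) \<le> norm ((f x)\<^sup>2 + (g x)\<^sup>2)"
    by (auto intro!: AE_I2 order_trans[OF _ abs_ge_self])
qed auto

lemma norm_diff_power2_le:
  fixes x y :: "'b::real_inner"
  shows "(norm (x - y))\<^sup>2 \<le> 2 * (norm x)\<^sup>2 + 2 * (norm y)\<^sup>2"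
proof -
  have "0 \<le> (norm (x + y))\<^sup>2" by simp
  then show ?thesis
    by (simp add: power2_norm_eq_inner inner_add inner_diff inner_commute)
qed

text \<open>Follows from \<open>norm (t *\<^sub>R x - y)\<close> being nonnegative. The free weight
  \<open>t\<close> allows the coefficient of \<open>x\<close> to be brought arbitrarily close to 1,
  at the price of a large coefficient for \<open>y\<close>; \<open>r_eq\<close> exploits
  this.\<close>

lemma norm_add_power2_le:
  fixes x y :: "'b::real_inner"
  assumes "0 < t"
  shows "(norm (x + y))\<^sup>2 \<le> (1 + t) * (norm x)\<^sup>2 + (1 + 1 / t) * (norm y)\<^sup>2"
proof -
  have "0 \<le> (norm (t *\<^sub>R x - y))\<^sup>2 / t"
    using assms by simp
  also have "\<dots> = t * (norm x)\<^sup>2 + (norm y)\<^sup>2 / t - 2 * (x \<bullet> y)"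
    using assms by (simp add: power2_norm_eq_inner inner_diff inner_commute field_simps)
  finally show ?thesis
    by (simp add: power2_norm_eq_inner inner_add inner_commute algebra_simps)
qed

lemma integrable_norm_diff_square:
  fixes f g :: "'a \<Rightarrow> 'b::{real_inner, second_countable_topology}"
  assumes [measurable]: "f \<in> borel_measurable M" "g \<in> borel_measurable M"
    and "integrable M (\<lambda>x. (norm (f x))\<^sup>2)" "integrable M (\<lambda>x. (norm (g x))\<^sup>2)"
  shows "integrable M (\<lambda>x. (norm (f x - g x))\<^sup>2)"
proof (rule Bochner_Integration.integrable_bound)
  show "integrable M (\<lambda>x. 2 * (norm (f x))\<^sup>2 + 2 * (norm (g x))\<^sup>2)"
    using assms by auto
  show "AE x in M. norm ((norm (f x - g x))\<^sup>2) \<le> norm (2 * (norm (f x))\<^sup>2 + 2 * (norm (g x))\<^sup>2)"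
    using norm_diff_power2_le by (auto intro!: AE_I2)
qed auto

lemma sq_moment_eq_integral:
  assumes "integrable M (\<lambda>x. (norm (f x))\<^sup>2)"
  shows "sq_moment M f = ennreal (\<integral>x. (norm (f x))\<^sup>2 \<partial>M)"
  unfolding sq_moment_def by (intro nn_integral_eq_integral assms) auto

lemma integrable_if_sq_moment_finite:
  fixes f :: "'a \<Rightarrow> 'b::{real_normed_vector, second_countable_topology}"
  assumes [measurable]: "f \<in> borel_measurable M" and "sq_moment M f < \<infinity>"
  shows "integrable M (\<lambda>x. (norm (f x))\<^sup>2)"
  using assms(2) unfolding sq_moment_def by (intro integrableI_bounded) auto

lemma emeasure_norm_gt_le:
  fixes f :: "'a \<Rightarrow> 'b::{real_normed_vector, second_countable_topology}"
  assumes [measurable]: "f \<in> borel_measurable M" and c: "0 < c"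
  shows "emeasure M {\<omega>\<in>space M. c < norm (f \<omega>)} \<le> ennreal (1 / c\<^sup>2) * sq_moment M f"
proof -
  have "emeasure M {\<omega>\<in>space M. c < norm (f \<omega>)} = (\<integral>\<^sup>+\<omega>. indicator {\<omega>\<in>space M. c < norm (f \<omega>)} \<omega> \<partial>M)"
    by simp
  also have "\<dots> \<le> (\<integral>\<^sup>+\<omega>. ennreal (1 / c\<^sup>2) * ennreal ((norm (f \<omega>))\<^sup>2) \<partial>M)"
  proof (rule nn_integral_mono)
    fix \<omega>
    show "indicator {\<omega>\<in>space M. c < norm (f \<omega>)} \<omega> \<le> ennreal (1 / c\<^sup>2) * ennreal ((norm (f \<omega>))\<^sup>2)"
    proof (cases "c < norm (f \<omega>)")
      case True
      then have "c\<^sup>2 \<le> (norm (f \<omega>))\<^sup>2"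
        using c by (intro power_mono) auto
      then have "1 \<le> ennreal (1 / c\<^sup>2 * (norm (f \<omega>))\<^sup>2)"
        using c by (simp add: field_simps)
      then show ?thesis
        by (subst ennreal_mult[symmetric]) (auto simp: indicator_def)
    qed simp
  qed
  also have "\<dots> = ennreal (1 / c\<^sup>2) * sq_moment M f"
    unfolding sq_moment_def by (rule nn_integral_cmult) simp
  finally show ?thesis .
qed

text \<open>\<open>has_cond_exp\<close> only tests against indicators of sets of \<open>F\<close>.
  Linearity extends this to vector-valued simple functions, and dominated convergence to a general
  \<open>Y\<close>; the integrability assumption supplies the dominating function.\<close>

lemma has_cond_exp_integral_inner:
  fixes f g Y :: "'a \<Rightarrow> 'b::{real_inner, banach, second_countable_topology}"
  assumes sub: "subalgebra M F" and ce: "has_cond_exp M F f g"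
    and Y: "Y \<in> borel_measurable F"
    and int: "integrable M (\<lambda>\<omega>. norm (Y \<omega>) * norm (f \<omega> - g \<omega>))"
  shows "(\<integral>\<omega>. Y \<omega> \<bullet> (f \<omega> - g \<omega>) \<partial>M) = 0"
proof -
  define D where "D \<omega> = f \<omega> - g \<omega>" for \<omega>
  have fg: "integrable M f" "integrable M g"
    using ce by (auto simp: has_cond_exp_def)
  then have D: "integrable M D"
    unfolding D_def by auto
  then have [measurable]: "D \<in> borel_measurable M"
    by auto
  have sp: "space F = space M" and sets: "A \<in> sets F \<Longrightarrow> A \<in> sets M" for A
    using sub by (auto simp: subalgebra_def)
  have [measurable]: "Y \<in> borel_measurable M"
    using measurable_from_subalg[OF sub Y] .
  have ind: "integrable M (\<lambda>\<omega>. indicator A \<omega> *\<^sub>R D \<omega>)"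
    "(\<integral>\<omega>. indicator A \<omega> *\<^sub>R D \<omega> \<partial>M) = 0" if A: "A \<in> sets F" for A
  proof -
    note i = integrable_mult_indicator[OF sets[OF A]]
    show "integrable M (\<lambda>\<omega>. indicator A \<omega> *\<^sub>R D \<omega>)"
      by (rule i[OF D])
    show "(\<integral>\<omega>. indicator A \<omega> *\<^sub>R D \<omega> \<partial>M) = 0"
      using ce A i[OF fg(1)] i[OF fg(2)]
      by (simp add: D_def has_cond_exp_def set_lebesgue_integral_def scaleR_diff_right)
  qed
  \<comment> \<open>Approximating relative to the centre 0 bounds the simple functions by
    \<open>2 * norm (Y x)\<close>, which is where the factor 2 in the dominating function comes
    from.\<close>
  obtain s where s: "\<And>i. simple_function F (s i)"
    and lim: "\<And>x. x \<in> space F \<Longrightarrow> (\<lambda>i. s i x) \<longlonglongrightarrow> Y x"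
    and bd: "\<And>i x. x \<in> space F \<Longrightarrow> norm (s i x) \<le> 2 * norm (Y x)"
    using borel_measurable_implies_sequence_metric[OF Y, of 0] unfolding dist_norm diff_zero by blast
  have [measurable]: "s i \<in> borel_measurable M" for i
    by (rule measurable_from_subalg[OF sub borel_measurable_simple_function[OF s]])
  have zero: "(\<integral>\<omega>. s i \<omega> \<bullet> D \<omega> \<partial>M) = 0" for i
  proof -
    \<comment> \<open>On the level set \<open>A y\<close> the simple function is the constant
      \<open>y\<close>, which can be pulled out of the integral; what remains is the integral of
      \<open>D\<close> over a set of \<open>F\<close>, which is 0.\<close>
    define A where "A y = s i -` {y} \<inter> space F" for y
    have A: "A y \<in> sets F" for y
      unfolding A_def by (rule simple_functionD(2)[OF s])
    have fin: "finite (s i ` space F)"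
      by (rule simple_functionD(1)[OF s])
    have "(\<integral>\<omega>. s i \<omega> \<bullet> D \<omega> \<partial>M)
        = (\<integral>\<omega>. (\<Sum>y\<in>s i ` space F. y \<bullet> (indicator (A y) \<omega> *\<^sub>R D \<omega>)) \<partial>M)"
    proof (rule Bochner_Integration.integral_cong[OF refl])
      fix \<omega> assume \<omega>: "\<omega> \<in> space M"
      have "(\<Sum>y\<in>s i ` space F. y \<bullet> (indicator (A y) \<omega> *\<^sub>R D \<omega>))
          = (\<Sum>y\<in>s i ` space F. if s i \<omega> = y then y \<bullet> D \<omega> else 0)"
        using \<omega> by (intro sum.cong) (auto simp: A_def sp indicator_def)
      also have "\<dots> = s i \<omega> \<bullet> D \<omega>"
        using fin \<omega> sp by (subst sum.delta') auto
      finally show "s i \<omega> \<bullet> D \<omega> = (\<Sum>y\<in>s i ` space F. y \<bullet> (indicator (A y) \<omega> *\<^sub>R D \<omega>))" ..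
    qed
    also have "\<dots> = (\<Sum>y\<in>s i ` space F. (\<integral>\<omega>. y \<bullet> (indicator (A y) \<omega> *\<^sub>R D \<omega>) \<partial>M))"
      by (intro Bochner_Integration.integral_sum integrable_inner_right ind A)
    also have "\<dots> = 0"
      using ind[OF A] by (intro sum.neutral ballI) (subst integral_inner_right; simp)
    finally show ?thesis .
  qed
  have "(\<lambda>i. \<integral>\<omega>. s i \<omega> \<bullet> D \<omega> \<partial>M) \<longlonglongrightarrow> (\<integral>\<omega>. Y \<omega> \<bullet> D \<omega> \<partial>M)"
  proof (rule integral_dominated_convergence)
    show "integrable M (\<lambda>\<omega>. 2 * (norm (Y \<omega>) * norm (D \<omega>)))"
      using int by (simp add: D_def)
    show "AE x in M. (\<lambda>i. s i x \<bullet> D x) \<longlonglongrightarrow> Y x \<bullet> D x"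
      using lim sp by (auto intro!: AE_I2 tendsto_inner)
    show "AE x in M. norm (s i x \<bullet> D x) \<le> 2 * (norm (Y x) * norm (D x))" for i
    proof (rule AE_I2)
      fix x assume x: "x \<in> space M"
      have "\<bar>s i x \<bullet> D x\<bar> \<le> norm (s i x) * norm (D x)"
        by (rule Cauchy_Schwarz_ineq2)
      also have "\<dots> \<le> (2 * norm (Y x)) * norm (D x)"
        using bd x sp by (intro mult_right_mono) auto
      finally show "norm (s i x \<bullet> D x) \<le> 2 * (norm (Y x) * norm (D x))"
        by simp
    qed
  qed auto
  from LIMSEQ_unique[OF this[unfolded zero] tendsto_const] show ?thesis
    by (simp add: D_def)
qed

subsection \<open>Martingales bounded in \<open>L\<^sup>2\<close>\<close>

text \<open>Time starts at 0 here, so that sequences and limits need no side condition on the index.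
  A martingale starting at \<open>n0\<close> is covered by shifting the index by
  \<open>n0\<close>.\<close>

locale L2_bounded_martingale = prob_space M for M :: "'a measure" +
  fixes F :: "nat \<Rightarrow> 'a measure"
    and X :: "nat \<Rightarrow> 'a \<Rightarrow> 'h::{real_inner, banach, second_countable_topology}"
  assumes subalg: "subalgebra M (F n)"
    and sets_mono: "n \<le> m \<Longrightarrow> sets (F n) \<subseteq> sets (F m)"
    and adapted: "X n \<in> borel_measurable (F n)"
    and mart: "n \<le> m \<Longrightarrow> has_cond_exp M (F n) (X m) (X n)"
    and bdd: "(SUP n. sq_moment M (X n)) < \<infinity>"
begin

lemma adapted_later: "n \<le> m \<Longrightarrow> X n \<in> borel_measurable (F m)"
  using adapted[of n] sets_mono[of n m] subalg
  by (auto simp: measurable_def subalgebra_def)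

lemma X_measurable [measurable]: "X n \<in> borel_measurable M"
  using measurable_from_subalg[OF subalg adapted] .

lemma X_square_integrable: "integrable M (\<lambda>\<omega>. (norm (X n \<omega>))\<^sup>2)"
proof (rule integrable_if_sq_moment_finite)
  have "sq_moment M (X n) \<le> (SUP n. sq_moment M (X n))"
    by (rule SUP_upper) simp
  then show "sq_moment M (X n) < \<infinity>"
    using bdd by (rule le_less_trans)
qed simp

lemma diff_square_integrable: "integrable M (\<lambda>\<omega>. (norm (X m \<omega> - X n \<omega>))\<^sup>2)"
  by (intro integrable_norm_diff_square X_square_integrable) auto

lemma orthogonal:
  assumes "k \<le> m" and Y: "Y \<in> borel_measurable (F k)"
    and sq: "integrable M (\<lambda>\<omega>. (norm (Y \<omega>))\<^sup>2)"
  shows "integrable M (\<lambda>\<omega>. Y \<omega> \<bullet> (X m \<omega> - X k \<omega>))" "expectation (\<lambda>\<omega>. Y \<omega> \<bullet> (X m \<omega> - X k \<omega>)) = 0"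
proof -
  have [measurable]: "Y \<in> borel_measurable M"
    using measurable_from_subalg[OF subalg Y] .
  have i: "integrable M (\<lambda>\<omega>. norm (Y \<omega>) * norm (X m \<omega> - X k \<omega>))"
    by (intro integrable_mult_square_integrable sq diff_square_integrable) auto
  show "expectation (\<lambda>\<omega>. Y \<omega> \<bullet> (X m \<omega> - X k \<omega>)) = 0"
    by (rule has_cond_exp_integral_inner[OF subalg mart[OF \<open>k \<le> m\<close>] Y i])
  show "integrable M (\<lambda>\<omega>. Y \<omega> \<bullet> (X m \<omega> - X k \<omega>))"
    by (rule Bochner_Integration.integrable_bound[OF i]) (auto simp: Cauchy_Schwarz_ineq2)
qed

section \<open>Second moments of the martingale and their limit\<close>

definition v :: "nat \<Rightarrow> real"
  where "v n = expectation (\<lambda>\<omega>. (norm (X n \<omega>))\<^sup>2)"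

text \<open>Pythagoras: \<open>orthogonal\<close> with \<open>Y = X n\<close> removes the cross
  term.\<close>

lemma expectation_diff_square:
  assumes "n \<le> m"
  shows "expectation (\<lambda>\<omega>. (norm (X m \<omega> - X n \<omega>))\<^sup>2) = v m - v n"
proof -
  note o = orthogonal[OF assms adapted X_square_integrable]
  have "v m = expectation (\<lambda>\<omega>. (norm (X n \<omega>))\<^sup>2 + (norm (X m \<omega> - X n \<omega>))\<^sup>2
      + 2 * (X n \<omega> \<bullet> (X m \<omega> - X n \<omega>)))"
    unfolding v_def
    by (intro Bochner_Integration.integral_cong refl)
      (simp add: power2_norm_eq_inner inner_diff inner_commute)
  also have "\<dots> = v n + expectation (\<lambda>\<omega>. (norm (X m \<omega> - X n \<omega>))\<^sup>2)"
    using o X_square_integrable diff_square_integrable by (simp add: v_def)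
  finally show ?thesis by simp
qed

lemma v_mono: "n \<le> m \<Longrightarrow> v n \<le> v m"
  using expectation_diff_square[of n m]
    Bochner_Integration.integral_nonneg[of M "\<lambda>\<omega>. (norm (X m \<omega> - X n \<omega>))\<^sup>2"] by simp

definition L :: real
  where "L = (SUP n. v n)"

lemma v_bdd: "bdd_above (range v)"
proof (rule bdd_aboveI2)
  fix n
  have "ennreal (v n) = sq_moment M (X n)"
    unfolding v_def using sq_moment_eq_integral[OF X_square_integrable] by simp
  also have "\<dots> \<le> (SUP n. sq_moment M (X n))"
    by (rule SUP_upper) simp
  finally show "v n \<le> enn2real (SUP n. sq_moment M (X n))"
    using bdd by (cases "SUP n. sq_moment M (X n)") auto
qed

lemma v_le_L: "v n \<le> L"
  unfolding L_def by (intro cSUP_upper v_bdd) simp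

lemma v_tendsto: "v \<longlonglongrightarrow> L"
  unfolding L_def by (intro LIMSEQ_incseq_SUP v_bdd) (auto intro: monoI v_mono)

section \<open>Maximal inequality and almost sure convergence\<close>

text \<open>Kolmogorov's argument: decompose according to the first index \<open>k\<close> at which the threshold is
  exceeded; on that event the increment after \<open>k\<close> is orthogonal to the increment up to \<open>k\<close>.\<close>

lemma maximal_inequality:
  assumes c: "0 < c"
  shows "c\<^sup>2 * prob {\<omega>\<in>space M. \<exists>k\<in>{n..N}. c < norm (X k \<omega> - X n \<omega>)} \<le> L - v n"
proof (cases "n \<le> N")
  case True
  define A where "A k = {\<omega>\<in>space M. c < norm (X k \<omega> - X n \<omega>) \<and>
    (\<forall>j\<in>{n..<k}. norm (X j \<omega> - X n \<omega>) \<le> c)}" for k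
  have A_F: "A k \<in> sets (F k)" if "n \<le> k" for k
  proof -
    have [measurable]: "j \<in> {n..<k} \<Longrightarrow> X j \<in> borel_measurable (F k)" for j
      by (rule adapted_later) auto
    have [measurable]: "X n \<in> borel_measurable (F k)" "X k \<in> borel_measurable (F k)"
      using that by (auto intro: adapted_later)
    have "space M = space (F k)"
      using subalg[of k] by (simp add: subalgebra_def)
    then show ?thesis
      unfolding A_def by simp
  qed
  then have A_M: "A k \<in> sets M" if "n \<le> k" for k
    using that subalg[of k] by (auto simp: subalgebra_def)
  have disj: "disjoint_family_on A {n..N}"
    unfolding disjoint_family_on_def
  proof (intro ballI impI)
    fix i j assume ij: "i \<in> {n..N}" "j \<in> {n..N}" "i \<noteq> j"
    have "A i \<inter> A j = {}" if "n \<le> i" "i < j" for i j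
    proof -
      have "i \<in> {n..<j}" using that by simp
      then show ?thesis unfolding A_def by (auto simp: not_le dest!: bspec[where x = i])
    qed
    from this[of i j] this[of j i] show "A i \<inter> A j = {}"
      using ij by (cases i j rule: linorder_cases) auto
  qed
  have eq: "{\<omega>\<in>space M. \<exists>k\<in>{n..N}. c < norm (X k \<omega> - X n \<omega>)} = (\<Union>k\<in>{n..N}. A k)"
  proof (intro equalityI subsetI)
    fix \<omega> assume \<omega>: "\<omega> \<in> {\<omega>\<in>space M. \<exists>k\<in>{n..N}. c < norm (X k \<omega> - X n \<omega>)}"
    define P where "P k \<longleftrightarrow> k \<in> {n..N} \<and> c < norm (X k \<omega> - X n \<omega>)" for k
    have "\<exists>k. P k" using \<omega> by (auto simp: P_def)
    then have "P (LEAST k. P k)" and "\<And>j. j < (LEAST k. P k) \<Longrightarrow> \<not> P j"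
      by (auto intro: LeastI_ex dest: not_less_Least)
    then have "\<omega> \<in> A (LEAST k. P k)"
      using \<omega> by (force simp: A_def P_def not_less)
    then show "\<omega> \<in> (\<Union>k\<in>{n..N}. A k)"
      using \<open>P (LEAST k. P k)\<close> by (auto simp: P_def)
  qed (auto simp: A_def)
  have step: "c\<^sup>2 * prob (A k) \<le> expectation (\<lambda>\<omega>. indicator (A k) \<omega> * (norm (X N \<omega> - X n \<omega>))\<^sup>2)"
    and step_int: "integrable M (\<lambda>\<omega>. indicator (A k) \<omega> * (norm (X N \<omega> - X n \<omega>))\<^sup>2)"
    if k: "k \<in> {n..N}" for k
  proof -
    have nk: "n \<le> k" "k \<le> N" using k by auto
    note [measurable] = A_M[OF nk(1)]
    \<comment> \<open>Cutting off by \<open>A k\<close> keeps the increment measurable with respect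
      to \<open>F k\<close>, so it remains orthogonal to \<open>X N - X k\<close>.\<close>
    define Y where "Y \<omega> = indicator (A k) \<omega> *\<^sub>R (X k \<omega> - X n \<omega>)" for \<omega>
    note i = integrable_mult_indicator[OF A_M[OF nk(1)], where 'b = real, simplified]
    have Y: "Y \<in> borel_measurable (F k)"
      unfolding Y_def using A_F[OF nk(1)]
      by (intro borel_measurable_scaleR borel_measurable_indicator borel_measurable_diff
          adapted_later nk) auto
    have Ysq: "(norm (Y \<omega>))\<^sup>2 = indicator (A k) \<omega> * (norm (X k \<omega> - X n \<omega>))\<^sup>2" for \<omega>
      by (simp add: Y_def indicator_def)
    have Yi: "integrable M (\<lambda>\<omega>. (norm (Y \<omega>))\<^sup>2)"
      unfolding Ysq by (intro i diff_square_integrable)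
    note o = orthogonal[OF nk(2) Y Yi]
    show int: "integrable M (\<lambda>\<omega>. indicator (A k) \<omega> * (norm (X N \<omega> - X n \<omega>))\<^sup>2)"
      by (intro i diff_square_integrable)
    \<comment> \<open>The inserted inner product has expectation 0. With it the comparison becomes
      pointwise: on \<open>A k\<close> it is the cross term in the expansion of the square of
      \<open>(X k - X n) + (X N - X k)\<close>, and the last square is dropped.\<close>
    have "c\<^sup>2 * prob (A k) = expectation (\<lambda>\<omega>. c\<^sup>2 * indicator (A k) \<omega> + 2 * (Y \<omega> \<bullet> (X N \<omega> - X k \<omega>)))"
      using o by (subst Bochner_Integration.integral_add) (auto simp: emeasure_eq_measure)
    also have "\<dots> \<le> expectation (\<lambda>\<omega>. indicator (A k) \<omega> * (norm (X N \<omega> - X n \<omega>))\<^sup>2)"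
    proof (rule integral_mono)
      show "integrable M (\<lambda>\<omega>. c\<^sup>2 * indicator (A k) \<omega> + 2 * (Y \<omega> \<bullet> (X N \<omega> - X k \<omega>)))"
        using o by (auto simp: emeasure_eq_measure)
      fix \<omega> assume "\<omega> \<in> space M"
      show "c\<^sup>2 * indicator (A k) \<omega> + 2 * (Y \<omega> \<bullet> (X N \<omega> - X k \<omega>))
          \<le> indicator (A k) \<omega> * (norm (X N \<omega> - X n \<omega>))\<^sup>2"
      proof (cases "\<omega> \<in> A k")
        case True
        then have "c\<^sup>2 \<le> (norm (X k \<omega> - X n \<omega>))\<^sup>2"
          using c by (intro power_mono) (auto simp: A_def)
        moreover have "(norm (X N \<omega> - X n \<omega>))\<^sup>2 = (norm (X k \<omega> - X n \<omega>))\<^sup>2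
            + 2 * ((X k \<omega> - X n \<omega>) \<bullet> (X N \<omega> - X k \<omega>)) + (norm (X N \<omega> - X k \<omega>))\<^sup>2"
          by (simp add: power2_norm_eq_inner inner_diff inner_commute)
        ultimately show ?thesis
          using True by (simp add: Y_def add_increasing2)
      qed (simp add: Y_def)
    qed (rule int)
    finally show "c\<^sup>2 * prob (A k) \<le> expectation (\<lambda>\<omega>. indicator (A k) \<omega> * (norm (X N \<omega> - X n \<omega>))\<^sup>2)" .
  qed
  have "c\<^sup>2 * prob (\<Union>k\<in>{n..N}. A k) = (\<Sum>k\<in>{n..N}. c\<^sup>2 * prob (A k))"
    using A_M disj by (subst finite_measure_finite_Union) (auto simp: sum_distrib_left)
  also have "\<dots> \<le> (\<Sum>k\<in>{n..N}. expectation (\<lambda>\<omega>. indicator (A k) \<omega> * (norm (X N \<omega> - X n \<omega>))\<^sup>2))"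
    by (intro sum_mono step)
  also have "\<dots> = expectation (\<lambda>\<omega>. \<Sum>k\<in>{n..N}. indicator (A k) \<omega> * (norm (X N \<omega> - X n \<omega>))\<^sup>2)"
    by (intro Bochner_Integration.integral_sum[symmetric] step_int)
  \<comment> \<open>The events \<open>A k\<close> are disjoint, so their indicators add up to at
    most 1.\<close>
  also have "\<dots> \<le> expectation (\<lambda>\<omega>. (norm (X N \<omega> - X n \<omega>))\<^sup>2)"
  proof (rule integral_mono)
    fix \<omega>
    have "(\<Sum>k\<in>{n..N}. indicator (A k) \<omega> * (norm (X N \<omega> - X n \<omega>))\<^sup>2)
        = indicator (\<Union>k\<in>{n..N}. A k) \<omega> * (norm (X N \<omega> - X n \<omega>))\<^sup>2"
      using disj by (simp add: sum_distrib_right[symmetric] indicator_UN_disjoint)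
    also have "\<dots> \<le> (norm (X N \<omega> - X n \<omega>))\<^sup>2"
      by (simp add: indicator_def)
    finally show "(\<Sum>k\<in>{n..N}. indicator (A k) \<omega> * (norm (X N \<omega> - X n \<omega>))\<^sup>2)
        \<le> (norm (X N \<omega> - X n \<omega>))\<^sup>2" .
  qed (intro Bochner_Integration.integrable_sum step_int diff_square_integrable | assumption)+
  also have "\<dots> \<le> L - v n"
    using expectation_diff_square[OF True] v_le_L[of N] by simp
  finally show ?thesis unfolding eq .
next
  case False
  then show ?thesis using v_le_L[of n] by simp
qed

text \<open>The bound in \<open>maximal_inequality\<close> does not depend on \<open>N\<close>, so
  it survives the increasing limit of the events.\<close>

lemma maximal_inequality_infinite:
  assumes c: "0 < c"
  shows "c\<^sup>2 * prob {\<omega>\<in>space M. \<exists>k\<ge>n. c < norm (X k \<omega> - X n \<omega>)} \<le> L - v n"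
proof -
  define B where "B N = {\<omega>\<in>space M. \<exists>k\<in>{n..N}. c < norm (X k \<omega> - X n \<omega>)}" for N
  have "(\<lambda>N. prob (B N)) \<longlonglongrightarrow> prob (\<Union>N. B N)"
    by (rule finite_Lim_measure_incseq) (auto simp: B_def incseq_def)
  then have "(\<lambda>N. c\<^sup>2 * prob (B N)) \<longlonglongrightarrow> c\<^sup>2 * prob (\<Union>N. B N)"
    by (intro tendsto_intros)
  then have "c\<^sup>2 * prob (\<Union>N. B N) \<le> L - v n"
    using maximal_inequality[OF c] by (intro LIMSEQ_le_const2) (auto simp: B_def)
  also have "(\<Union>N. B N) = {\<omega>\<in>space M. \<exists>k\<ge>n. c < norm (X k \<omega> - X n \<omega>)}"
  proof (intro equalityI subsetI)
    fix \<omega> assume "\<omega> \<in> {\<omega>\<in>space M. \<exists>k\<ge>n. c < norm (X k \<omega> - X n \<omega>)}"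
    then obtain k where "\<omega> \<in> space M" "n \<le> k" "c < norm (X k \<omega> - X n \<omega>)"
      by auto
    then have "\<omega> \<in> B k"
      by (auto simp: B_def)
    then show "\<omega> \<in> (\<Union>N. B N)"
      by blast
  qed (auto simp: B_def)
  finally show ?thesis .
qed

text \<open>The exceptional event is contained in the event of
  \<open>maximal_inequality_infinite\<close> for every \<open>n\<close>, and the bounds
  \<open>L - v n\<close> tend to 0.\<close>

lemma AE_eventually_close:
  assumes c: "0 < c"
  shows "AE \<omega> in M. \<exists>n. \<forall>k\<ge>n. norm (X k \<omega> - X n \<omega>) \<le> c"
proof -
  define N where "N = {\<omega>\<in>space M. \<forall>n. \<exists>k\<ge>n. c < norm (X k \<omega> - X n \<omega>)}"
  have "c\<^sup>2 * prob N \<le> L - v n" for n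
  proof -
    have "prob N \<le> prob {\<omega>\<in>space M. \<exists>k\<ge>n. c < norm (X k \<omega> - X n \<omega>)}"
      by (intro finite_measure_mono) (auto simp: N_def)
    then have "c\<^sup>2 * prob N \<le> c\<^sup>2 * prob {\<omega>\<in>space M. \<exists>k\<ge>n. c < norm (X k \<omega> - X n \<omega>)}"
      by (intro mult_left_mono) auto
    then show ?thesis
      using maximal_inequality_infinite[OF c, of n] by linarith
  qed
  moreover have "(\<lambda>n. L - v n) \<longlonglongrightarrow> L - L"
    by (intro tendsto_intros v_tendsto)
  ultimately have "c\<^sup>2 * prob N \<le> 0"
    by (intro LIMSEQ_le_const[of "\<lambda>n. L - v n"]) auto
  then have "prob N = 0"
    using c by (simp add: mult_le_0_iff measure_le_0_iff)
  moreover have "N \<in> sets M"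
    unfolding N_def by measurable
  ultimately have "N \<in> null_sets M"
    by (auto simp: emeasure_eq_measure)
  then show ?thesis
    by (rule AE_I') (auto simp: N_def not_le)
qed

text \<open>Countably many thresholds suffice for the Cauchy property, so a single null set can be
  discarded; completeness does the rest.\<close>

lemma AE_convergent: "AE \<omega> in M. convergent (\<lambda>n. X n \<omega>)"
proof -
  have "AE \<omega> in M. \<forall>j. \<exists>n. \<forall>k\<ge>n. norm (X k \<omega> - X n \<omega>) \<le> 1 / real (Suc j)"
    unfolding AE_all_countable by (auto intro: AE_eventually_close)
  then show ?thesis
  proof eventually_elim
    case (elim \<omega>)
    have "Cauchy (\<lambda>n. X n \<omega>)"
    proof (rule metric_CauchyI)
      fix e :: real assume "0 < e"
      \<comment> \<open>Half of \<open>e\<close>, because two late terms are compared through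
        \<open>X n\<close>.\<close>
      then obtain j where j: "inverse (real (Suc j)) < e / 2"
        using reals_Archimedean[of "e / 2"] by auto
      obtain n where n: "\<And>k. k \<ge> n \<Longrightarrow> norm (X k \<omega> - X n \<omega>) \<le> 1 / real (Suc j)"
        using elim by blast
      have "dist (X k \<omega>) (X l \<omega>) < e" if "n \<le> k" "n \<le> l" for k l
        using n[OF that(1)] n[OF that(2)] j dist_triangle2[of "X k \<omega>" "X l \<omega>" "X n \<omega>"]
        by (simp add: dist_norm inverse_eq_divide)
      then show "\<exists>M. \<forall>m\<ge>M. \<forall>n\<ge>M. dist (X m \<omega>) (X n \<omega>) < e"
        by blast
    qed
    then show ?case
      by (rule Cauchy_convergent)
  qed
qed

section \<open>The limit and the exact squared distance to it\<close>

definition Xlim :: "'a \<Rightarrow> 'h"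
  where "Xlim \<omega> = lim (\<lambda>n. X n \<omega>)"

lemma Xlim_measurable [measurable]: "Xlim \<in> borel_measurable M"
  unfolding Xlim_def[abs_def] by measurable

lemma AE_tendsto_Xlim: "AE \<omega> in M. (\<lambda>n. X n \<omega>) \<longlonglongrightarrow> Xlim \<omega>"
  using AE_convergent unfolding Xlim_def convergent_LIMSEQ_iff .

text \<open>Fatou's lemma applied to \<open>X n - X m\<close> as \<open>m\<close> grows; for
  \<open>m \<ge> n\<close> its second moment is \<open>v m - v n\<close>, hence at most
  \<open>L - v n\<close>.\<close>

lemma sq_moment_diff_Xlim_le: "sq_moment M (\<lambda>\<omega>. X n \<omega> - Xlim \<omega>) \<le> ennreal (L - v n)"
proof -
  have "sq_moment M (\<lambda>\<omega>. X n \<omega> - Xlim \<omega>)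
      = (\<integral>\<^sup>+\<omega>. liminf (\<lambda>m. ennreal ((norm (X n \<omega> - X m \<omega>))\<^sup>2)) \<partial>M)"
    unfolding sq_moment_def
  proof (rule nn_integral_cong_AE)
    show "AE \<omega> in M. ennreal ((norm (X n \<omega> - Xlim \<omega>))\<^sup>2)
        = liminf (\<lambda>m. ennreal ((norm (X n \<omega> - X m \<omega>))\<^sup>2))"
      using AE_tendsto_Xlim
    proof eventually_elim
      case (elim \<omega>)
      have "(\<lambda>m. ennreal ((norm (X n \<omega> - X m \<omega>))\<^sup>2)) \<longlonglongrightarrow> ennreal ((norm (X n \<omega> - Xlim \<omega>))\<^sup>2)"
        by (intro tendsto_intros elim)
      then show ?case
        by (rule lim_imp_Liminf[symmetric, rotated]) simp
    qed
  qed
  also have "\<dots> \<le> liminf (\<lambda>m. \<integral>\<^sup>+\<omega>. ennreal ((norm (X n \<omega> - X m \<omega>))\<^sup>2) \<partial>M)"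
    by (rule nn_integral_liminf) simp
  also have "\<dots> \<le> ennreal (L - v n)"
  proof (rule Liminf_le)
    show "\<forall>\<^sub>F m in sequentially. (\<integral>\<^sup>+\<omega>. ennreal ((norm (X n \<omega> - X m \<omega>))\<^sup>2) \<partial>M) \<le> ennreal (L - v n)"
      using eventually_ge_at_top[of n]
    proof eventually_elim
      case (elim m)
      have "(\<integral>\<^sup>+\<omega>. ennreal ((norm (X n \<omega> - X m \<omega>))\<^sup>2) \<partial>M) = ennreal (v m - v n)"
        using expectation_diff_square[OF elim]
        by (subst nn_integral_eq_integral) (auto simp: norm_minus_commute[of "X n _"] diff_square_integrable)
      then show ?case
        using v_le_L[of m] by (simp add: ennreal_leI)
    qed
  qed simp
  finally show ?thesis .
qed

lemma diff_Xlim_square_integrable: "integrable M (\<lambda>\<omega>. (norm (X n \<omega> - Xlim \<omega>))\<^sup>2)"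
  using le_less_trans[OF sq_moment_diff_Xlim_le[of n], of \<infinity>]
  by (intro integrable_if_sq_moment_finite) auto

definition r :: "nat \<Rightarrow> real"
  where "r n = expectation (\<lambda>\<omega>. (norm (X n \<omega> - Xlim \<omega>))\<^sup>2)"

lemma r_nonneg: "0 \<le> r n"
  by (simp add: r_def)

lemma sq_moment_diff_Xlim: "sq_moment M (\<lambda>\<omega>. X n \<omega> - Xlim \<omega>) = ennreal (r n)"
  unfolding r_def by (intro sq_moment_eq_integral diff_Xlim_square_integrable)

lemma r_le: "r n \<le> L - v n"
  using sq_moment_diff_Xlim_le[of n] v_le_L[of n] by (simp add: sq_moment_diff_Xlim)

lemma r_tendsto: "r \<longlonglongrightarrow> 0"
proof (rule tendsto_sandwich[OF _ _ tendsto_const])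
  show "(\<lambda>n. L - v n) \<longlonglongrightarrow> 0"
    using tendsto_diff[OF tendsto_const v_tendsto, of L] by simp
qed (auto simp: r_nonneg r_le)

text \<open>Fatou only gives one inequality. For the other one, \<open>X m - X n\<close> is split at
  \<open>Xlim\<close> with weight \<open>t\<close>: first \<open>m\<close> tends to infinity, which
  kills the term with \<open>1 / t\<close> because \<open>r m\<close> tends to 0, and then
  \<open>t\<close> tends to 0 from the right.\<close>

lemma r_eq: "r n = L - v n"
proof (rule antisym[OF r_le])
  have *: "L - v n \<le> (1 + t) * r n" if t: "0 < t" for t
  proof (rule LIMSEQ_le)
    show "(\<lambda>m. v m - v n) \<longlonglongrightarrow> L - v n"
      by (intro tendsto_intros v_tendsto)
    have "(\<lambda>m. (1 + t) * r n + (1 + 1 / t) * r m) \<longlonglongrightarrow> (1 + t) * r n + (1 + 1 / t) * 0"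
      by (intro tendsto_intros r_tendsto)
    then show "(\<lambda>m. (1 + t) * r n + (1 + 1 / t) * r m) \<longlonglongrightarrow> (1 + t) * r n"
      by simp
    have "v m - v n \<le> (1 + t) * r n + (1 + 1 / t) * r m" if "n \<le> m" for m
    proof -
      have "v m - v n = expectation (\<lambda>\<omega>. (norm (X m \<omega> - X n \<omega>))\<^sup>2)"
        by (simp add: expectation_diff_square that)
      also have "\<dots> \<le> expectation (\<lambda>\<omega>. (1 + t) * (norm (X n \<omega> - Xlim \<omega>))\<^sup>2
          + (1 + 1 / t) * (norm (X m \<omega> - Xlim \<omega>))\<^sup>2)"
      proof (rule integral_mono)
        fix \<omega>
        show "(norm (X m \<omega> - X n \<omega>))\<^sup>2 \<le> (1 + t) * (norm (X n \<omega> - Xlim \<omega>))\<^sup>2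
          + (1 + 1 / t) * (norm (X m \<omega> - Xlim \<omega>))\<^sup>2"
          using norm_add_power2_le[OF t, of "X n \<omega> - Xlim \<omega>" "Xlim \<omega> - X m \<omega>"]
          by (simp add: norm_minus_commute)
      qed (auto intro!: diff_square_integrable diff_Xlim_square_integrable)
      also have "\<dots> = (1 + t) * r n + (1 + 1 / t) * r m"
        unfolding r_def using diff_Xlim_square_integrable by simp
      finally show ?thesis .
    qed
    then show "\<exists>N. \<forall>m\<ge>N. v m - v n \<le> (1 + t) * r n + (1 + 1 / t) * r m"
      by blast
  qed
  show "L - v n \<le> r n"
  proof (rule tendsto_lowerbound)
    have "((\<lambda>t. (1 + t) * r n) \<longlongrightarrow> (1 + 0) * r n) (at_right 0)"
      by (intro tendsto_intros)
    then show "((\<lambda>t. (1 + t) * r n) \<longlongrightarrow> r n) (at_right 0)"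
      by simp
    show "\<forall>\<^sub>F t in at_right 0. L - v n \<le> (1 + t) * r n"
      using eventually_at_right_less[of "0::real"] by eventually_elim (rule *)
  qed simp
qed

text \<open>Each increment contributes a difference of consecutive values of \<open>v\<close>, so
  the series telescopes to \<open>L - v n\<close>.\<close>

lemma incr_tail_eq: "incr_tail M X n = ennreal (r n)"
proof -
  have "sq_moment M (incr X (n + 1 + k)) = ennreal (v (Suc k + n) - v (k + n))" for k
  proof -
    have "incr X (n + 1 + k) = (\<lambda>\<omega>. X (Suc k + n) \<omega> - X (k + n) \<omega>)"
      by (auto simp: incr_def add.commute)
    then show ?thesis
      using expectation_diff_square[of "k + n" "Suc k + n"]
      by (simp add: sq_moment_eq_integral diff_square_integrable)
  qed
  moreover have "(\<lambda>k. v (Suc k + n) - v (k + n)) sums (L - v (0 + n))"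
    by (rule telescope_sums) (rule LIMSEQ_ignore_initial_segment[OF v_tendsto])
  then have "(\<lambda>k. ennreal (v (Suc k + n) - v (k + n))) sums ennreal (r n)"
    using v_le_L[of n] by (subst sums_ennreal) (auto simp: r_eq v_mono)
  ultimately show ?thesis
    unfolding incr_tail_def by (simp add: sums_iff)
qed

lemma Xlim_sq_moment_finite: "sq_moment M Xlim < \<infinity>"
proof -
  have "integrable M (\<lambda>\<omega>. (norm (X 0 \<omega> - (X 0 \<omega> - Xlim \<omega>)))\<^sup>2)"
    by (intro integrable_norm_diff_square X_square_integrable diff_Xlim_square_integrable) auto
  then show ?thesis
    by (simp add: sq_moment_eq_integral)
qed

end

subsection \<open>Deviation frequencies\<close>

text \<open>A single series for finite and infinite \<open>N\<close>, in which \<open>N\<close> only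
  enters through a condition on each term. Monotonicity in \<open>N\<close> and the exchange of sum
  and integral then become termwise statements.\<close>

lemma S_sum_eq_suminf: "S_sum a n0 N = (\<Sum>i. if enat i < N then ennreal (a (n0 + i)) else 0)"
proof (cases N)
  case (enat k)
  have "(\<Sum>i. if enat i < N then ennreal (a (n0 + i)) else 0)
      = (\<Sum>i<k. if enat i < N then ennreal (a (n0 + i)) else 0)"
    by (rule suminf_finite) (auto simp: enat)
  then show ?thesis
    by (simp add: S_sum_def enat)
qed (simp add: S_sum_def)

lemma S_sum_mono: "N \<le> N' \<Longrightarrow> S_sum a n0 N \<le> S_sum a n0 N'"
  unfolding S_sum_eq_suminf by (intro suminf_le summableI) (auto dest: order_less_le_trans)

lemma enat_less_last_dev_rank:
  "enat i < last_dev_rank n0 \<epsilon> d \<longleftrightarrow> (\<exists>m\<ge>n0 + i. \<epsilon> m < d m)"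
proof -
  \<comment> \<open>The condition \<open>n0 \<le> m\<close> matters: for \<open>m < n0\<close>
    truncated subtraction gives \<open>m - n0 + 1 = 1\<close>, which exceeds
    \<open>i = 0\<close>.\<close>
  have "n0 \<le> m \<and> i < m - n0 + 1 \<longleftrightarrow> n0 + i \<le> m" for m
    by auto
  moreover have "enat i < last_dev_rank n0 \<epsilon> d
      \<longleftrightarrow> (\<exists>m. (n0 \<le> m \<and> i < m - n0 + 1) \<and> \<epsilon> m < d m)"
    unfolding last_dev_rank_def less_SUP_iff by auto
  ultimately show ?thesis
    by simp
qed

text \<open>Induction over the partial counts: without a deviation at \<open>n0 + n\<close> the
  count stays the same, and with one the rank is at least \<open>n + 1\<close>, which bounds any
  count over \<open>n + 1\<close> indices. This treats infinitely many deviations as well.\<close>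

lemma overlap_count_le_last_dev_rank: "overlap_count n0 \<epsilon> d \<le> last_dev_rank n0 \<epsilon> d"
proof -
  define f :: "nat \<Rightarrow> enat" where "f k = (if d (n0 + k) > \<epsilon> (n0 + k) then 1 else 0)" for k
  have bound: "sum f {..<n} \<le> enat n" for n
  proof (induction n)
    case (Suc n)
    have "sum f {..<n} + f n \<le> enat n + 1"
      using Suc by (intro add_mono) (auto simp: f_def)
    then show ?case
      by (simp add: one_enat_def)
  qed (simp add: zero_enat_def)
  have "sum f {..<n} \<le> last_dev_rank n0 \<epsilon> d" for n
  proof (induction n)
    case (Suc n)
    show ?case
    proof (cases "d (n0 + n) > \<epsilon> (n0 + n)")
      case True
      then have "enat n < last_dev_rank n0 \<epsilon> d"
        by (auto simp: enat_less_last_dev_rank)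
      then have "enat (Suc n) \<le> last_dev_rank n0 \<epsilon> d"
        by (metis Suc_ile_eq)
      then show ?thesis
        using bound[of "Suc n"] by (rule order_trans[rotated])
    next
      case False
      then show ?thesis
        using Suc by (simp add: f_def)
    qed
  qed simp
  then show ?thesis
    unfolding overlap_count_def f_def[symmetric]
    by (intro suminf_le_const) auto
qed

text \<open>Index and rank differ by the shift \<open>1 - n0\<close>, whose sign decides the
  direction of the comparison here and in the next lemma.\<close>

lemma last_dev_rank_le_last_dev: "1 \<le> n0 \<Longrightarrow> last_dev_rank n0 \<epsilon> d \<le> last_dev n0 \<epsilon> d"
  unfolding last_dev_rank_def last_dev_def by (rule SUP_mono) auto

lemma last_dev_le_last_dev_rank: "n0 \<le> 1 \<Longrightarrow> last_dev n0 \<epsilon> d \<le> last_dev_rank n0 \<epsilon> d"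
  unfolding last_dev_rank_def last_dev_def by (rule SUP_mono) auto

lemma nn_integral_S_sum_last_dev_rank_le:
  assumes sets: "\<And>n. n \<ge> n0 \<Longrightarrow> {\<omega>\<in>space M. \<epsilon> n < d \<omega> n} \<in> sets M"
    and le: "\<And>n. n \<ge> n0 \<Longrightarrow> emeasure M {\<omega>\<in>space M. \<epsilon> n < d \<omega> n} \<le> p n"
  shows "(\<integral>\<^sup>+\<omega>. S_sum a n0 (last_dev_rank n0 \<epsilon> (d \<omega>)) \<partial>M)
    \<le> (\<Sum>i. ennreal (a (n0 + i)) * (\<Sum>j. p (n0 + i + j)))"
proof -
  define D where "D n = {\<omega>\<in>space M. \<epsilon> n < d \<omega> n}" for n
  \<comment> \<open>\<open>B i\<close> is the event that the rank of the last deviation exceeds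
    \<open>i\<close>, that is, that the summand \<open>a (n0 + i)\<close> occurs.\<close>
  define B where "B i = (\<Union>j. D (n0 + i + j))" for i
  have D: "D (n0 + i + j) \<in> sets M" for i j
    unfolding D_def by (rule sets) simp
  then have [measurable]: "B i \<in> sets M" for i
    unfolding B_def by auto
  have mem: "\<omega> \<in> B i \<longleftrightarrow> (\<exists>m\<ge>n0 + i. \<epsilon> m < d \<omega> m)" if "\<omega> \<in> space M" for \<omega> i
    using that by (auto simp: B_def D_def le_iff_add)
  have "(\<integral>\<^sup>+\<omega>. S_sum a n0 (last_dev_rank n0 \<epsilon> (d \<omega>)) \<partial>M)
      = (\<integral>\<^sup>+\<omega>. (\<Sum>i. ennreal (a (n0 + i)) * indicator (B i) \<omega>) \<partial>M)"
    by (intro nn_integral_cong)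
      (auto simp: S_sum_eq_suminf enat_less_last_dev_rank mem indicator_def intro!: suminf_cong)
  also have "\<dots> = (\<Sum>i. ennreal (a (n0 + i)) * emeasure M (B i))"
    by (subst nn_integral_suminf) (auto simp: nn_integral_cmult_indicator)
  also have "\<dots> \<le> (\<Sum>i. ennreal (a (n0 + i)) * (\<Sum>j. p (n0 + i + j)))"
  proof (intro suminf_le summableI mult_left_mono)
    fix i
    have "emeasure M (B i) \<le> (\<Sum>j. emeasure M (D (n0 + i + j)))"
      unfolding B_def using D by (intro emeasure_subadditive_countably) auto
    also have "\<dots> \<le> (\<Sum>j. p (n0 + i + j))"
      unfolding D_def by (intro suminf_le summableI le) simp
    finally show "emeasure M (B i) \<le> (\<Sum>j. p (n0 + i + j))" .
  qed simp
  finally show ?thesis .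
qed

text \<open>By Borel-Cantelli almost surely only finitely many deviations occur, so the quotient is
  eventually at most 1.\<close>

lemma AE_limsup_le_1:
  fixes d :: "'a \<Rightarrow> nat \<Rightarrow> real"
  assumes sets: "\<And>n. n \<ge> n0 \<Longrightarrow> {\<omega>\<in>space M. \<epsilon> n < d \<omega> n} \<in> sets M"
    and le: "\<And>n. n \<ge> n0 \<Longrightarrow> emeasure M {\<omega>\<in>space M. \<epsilon> n < d \<omega> n} \<le> p n"
    and fin: "(\<Sum>j. p (n0 + j)) < \<infinity>" and pos: "\<And>n. n \<ge> n0 \<Longrightarrow> 0 < \<epsilon> n"
  shows "AE \<omega> in M. limsup (\<lambda>n. ereal (d \<omega> n * inverse (\<epsilon> n))) \<le> 1"
proof -
  define D where "D n = {\<omega>\<in>space M. \<epsilon> (n0 + n) < d \<omega> (n0 + n)}" for n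
  have D: "D n \<in> sets M" for n
    unfolding D_def by (rule sets) simp
  have "(\<Sum>n. emeasure M (D n)) \<le> (\<Sum>j. p (n0 + j))"
    unfolding D_def by (intro suminf_le summableI le) simp
  then have sum: "(\<Sum>n. emeasure M (D n)) < \<infinity>"
    using fin by (rule le_less_trans)
  then have D_fin: "emeasure M (D n) < \<infinity>" for n
    by (rule ennreal_suminf_lessD)
  then have "emeasure M (D n) = ennreal (measure M (D n))" for n
    by (intro emeasure_eq_ennreal_measure) (auto simp: less_top)
  then have "summable (\<lambda>n. measure M (D n))"
    using sum by (intro summable_suminf_not_top) (auto simp: less_top)
  from borel_cantelli_AE1[OF D D_fin this]
  show ?thesis
  proof eventually_elim
    case (elim \<omega>)
    then have "\<forall>\<^sub>F n in sequentially. d \<omega> (n + n0) \<le> \<epsilon> (n + n0)"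
      by eventually_elim (auto simp: D_def not_less add.commute)
    then have "\<forall>\<^sub>F n in sequentially. d \<omega> n \<le> \<epsilon> n"
      by (subst (asm) eventually_sequentially_seg)
    then have "\<forall>\<^sub>F n in sequentially. ereal (d \<omega> n * inverse (\<epsilon> n)) \<le> 1"
      using eventually_ge_at_top[of n0]
    proof eventually_elim
      case (elim n)
      then have "d \<omega> n * inverse (\<epsilon> n) \<le> 1"
        using pos[of n] by (simp add: field_simps)
      then show ?case
        by (simp add: one_ereal_def)
    qed
    then show ?case
      by (rule Limsup_bounded)
  qed
qed

section \<open>Return to the starting index \<open>n0\<close> and conclusion\<close>

text \<open>Only increments at indices \<open>n + 1 + k\<close>, which are positive, enter the tail,
  so the truncated predecessor in \<open>incr\<close> commutes with the shift.\<close>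

lemma incr_tail_shift: "incr_tail M (\<lambda>n. X (n + n0)) n = incr_tail M X (n + n0)"
proof -
  have "incr (\<lambda>n. X (n + n0)) (n + 1 + k) = incr X (n + n0 + 1 + k)" for k
    by (simp add: incr_def fun_eq_iff add_ac)
  then show ?thesis
    by (simp only: incr_tail_def)
qed

text \<open>The chain through \<open>last_dev\<close> depends on the convention for
  \<open>n0\<close>. For \<open>n0 = 0\<close> a single deviation at index 0 gives count 1 but
  \<open>last_dev\<close> 0, so \<open>E_O \<le> E_m\<close> can fail; for \<open>n0 \<ge> 2\<close>
  the index exceeds the rank, and \<open>E_m \<le> K\<close> can fail. The chain through
  \<open>last_dev_rank\<close> holds for every \<open>n0\<close>, and for \<open>n0 = 1\<close> both
  chains agree.\<close>

theorem theorem1: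
  fixes M :: "'a measure" and F :: "nat \<Rightarrow> 'a measure" and n0 :: nat
    and X :: "nat \<Rightarrow> 'a \<Rightarrow> 'h::{real_inner, banach, second_countable_topology}"
  assumes "prob_space M"
    and "filtration (space M) F"
    and "\<And>n. subalgebra M (F n)"
    and "martingale_from n0 M F X"
    and "(SUP n\<in>{n0..}. sq_moment M (X n)) < \<infinity>"
  shows "\<exists>Xinf :: 'a \<Rightarrow> 'h.
    Xinf \<in> borel_measurable M \<and> sq_moment M Xinf < \<infinity> \<and>
    (AE \<omega> in M. (\<lambda>n. X n \<omega>) \<longlonglongrightarrow> Xinf \<omega>) \<and>
    (\<lambda>n. sq_moment M (\<lambda>\<omega>. X n \<omega> - Xinf \<omega>)) \<longlonglongrightarrow> 0 \<and>
    (\<forall>\<epsilon>. (\<forall>n\<ge>n0. 0 < \<epsilon> n) \<and> antimono_on {n0..} \<epsilon> \<longrightarrow>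
      (\<forall>n\<ge>n0.
        emeasure M {\<omega>\<in>space M. norm (X n \<omega> - Xinf \<omega>) > \<epsilon> n}
          \<le> ennreal (1 / (\<epsilon> n)\<^sup>2) * sq_moment M (\<lambda>\<omega>. X n \<omega> - Xinf \<omega>) \<and>
        sq_moment M (\<lambda>\<omega>. X n \<omega> - Xinf \<omega>) = incr_tail M X n)) \<and>
    (\<forall>\<epsilon> a. (\<forall>n\<ge>n0. 0 < \<epsilon> n) \<and> antimono_on {n0..} \<epsilon> \<and>
        (\<forall>n\<ge>n0. 0 < a n) \<and> mono_on {n0..} a \<and>
        K_const n0 a \<epsilon> (incr_tail M X) < \<infinity> \<longrightarrow>
      (AE \<omega> in M. limsup (\<lambda>n. ereal (norm (X n \<omega> - Xinf \<omega>) * inverse (\<epsilon> n))) \<le> 1) \<and>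
      (let E_O = (\<integral>\<^sup>+\<omega>. S_sum a n0 (overlap_count n0 \<epsilon> (\<lambda>n. norm (X n \<omega> - Xinf \<omega>))) \<partial>M);
           E_m = (\<integral>\<^sup>+\<omega>. S_sum a n0 (last_dev n0 \<epsilon> (\<lambda>n. norm (X n \<omega> - Xinf \<omega>))) \<partial>M);
           E_r = (\<integral>\<^sup>+\<omega>. S_sum a n0 (last_dev_rank n0 \<epsilon> (\<lambda>n. norm (X n \<omega> - Xinf \<omega>))) \<partial>M);
           K = K_const n0 a \<epsilon> (incr_tail M X)
       in E_O \<le> E_r \<and> E_r \<le> K \<and>
          (1 \<le> n0 \<longrightarrow> E_O \<le> E_m) \<and> (n0 \<le> 1 \<longrightarrow> E_m \<le> K)))"
proof -
  interpret L2_bounded_martingale M "\<lambda>n. F (n + n0)" "\<lambda>n. X (n + n0)"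
  proof (intro L2_bounded_martingale.intro L2_bounded_martingale_axioms.intro)
    show "sets (F (n + n0)) \<subseteq> sets (F (m + n0))" if "n \<le> m" for n m
      using filtration.sets_F_mono[OF assms(2), of "n + n0" "m + n0"] that by simp
    have "(SUP n. sq_moment M (X (n + n0))) \<le> (SUP n\<in>{n0..}. sq_moment M (X n))"
      by (intro SUP_subset_mono SUP_mono) (metis UNIV_I atLeast_iff le_add2 order_refl)
    then show "(SUP n. sq_moment M (X (n + n0))) < \<infinity>"
      using assms(5) by (rule le_less_trans)
  qed (use assms in \<open>auto simp: martingale_from_def\<close>)
  have X_meas: "X n \<in> borel_measurable M" if "n0 \<le> n" for n
    using X_measurable[of "n - n0"] that by simp
  have tail: "sq_moment M (\<lambda>\<omega>. X n \<omega> - Xlim \<omega>) = incr_tail M X n" if "n0 \<le> n" for n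
    using sq_moment_diff_Xlim[of "n - n0"] incr_tail_eq[of "n - n0"] that
    by (simp add: incr_tail_shift)
  have cheb: "emeasure M {\<omega>\<in>space M. c < norm (X n \<omega> - Xlim \<omega>)}
      \<le> ennreal (1 / c\<^sup>2) * sq_moment M (\<lambda>\<omega>. X n \<omega> - Xlim \<omega>)" if "n0 \<le> n" "0 < c" for n c
    using X_meas[OF that(1)] that(2) by (intro emeasure_norm_gt_le) auto
  show ?thesis
  proof (intro exI[of _ Xlim] conjI allI impI)
    show "AE \<omega> in M. (\<lambda>n. X n \<omega>) \<longlonglongrightarrow> Xlim \<omega>"
      using AE_tendsto_Xlim by eventually_elim (rule LIMSEQ_offset)
    have "(\<lambda>n. sq_moment M (\<lambda>\<omega>. X (n + n0) \<omega> - Xlim \<omega>)) \<longlonglongrightarrow> ennreal 0"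
      unfolding sq_moment_diff_Xlim by (intro tendsto_ennrealI r_tendsto)
    then show "(\<lambda>n. sq_moment M (\<lambda>\<omega>. X n \<omega> - Xlim \<omega>)) \<longlonglongrightarrow> 0"
      unfolding ennreal_0 by (rule LIMSEQ_offset)
  next
    fix \<epsilon> :: "nat \<Rightarrow> real" and n
    assume "(\<forall>n\<ge>n0. 0 < \<epsilon> n) \<and> antimono_on {n0..} \<epsilon>" and n: "n0 \<le> n"
    then show "emeasure M {\<omega>\<in>space M. norm (X n \<omega> - Xlim \<omega>) > \<epsilon> n}
        \<le> ennreal (1 / (\<epsilon> n)\<^sup>2) * sq_moment M (\<lambda>\<omega>. X n \<omega> - Xlim \<omega>)"
      by (intro cheb) auto
    show "sq_moment M (\<lambda>\<omega>. X n \<omega> - Xlim \<omega>) = incr_tail M X n"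
      using n by (rule tail)
  next
    fix \<epsilon> a :: "nat \<Rightarrow> real"
    assume A: "(\<forall>n\<ge>n0. 0 < \<epsilon> n) \<and> antimono_on {n0..} \<epsilon> \<and>
        (\<forall>n\<ge>n0. 0 < a n) \<and> mono_on {n0..} a \<and>
        K_const n0 a \<epsilon> (incr_tail M X) < \<infinity>"
    \<comment> \<open>The Chebyshev bound for a deviation at \<open>n\<close>, with the second
      moment already replaced by the tail sum.\<close>
    define p where "p n = ennreal (1 / (\<epsilon> n)\<^sup>2) * incr_tail M X n" for n
    define d where "d \<omega> n = norm (X n \<omega> - Xlim \<omega>)" for \<omega> n
    have K: "K_const n0 a \<epsilon> (incr_tail M X) = (\<Sum>i. ennreal (a (n0 + i)) * (\<Sum>j. p (n0 + i + j)))"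
      by (simp add: K_const_def p_def)
    have sets: "{\<omega>\<in>space M. \<epsilon> n < d \<omega> n} \<in> sets M" if "n0 \<le> n" for n
      using X_meas[OF that] unfolding d_def by measurable
    have le: "emeasure M {\<omega>\<in>space M. \<epsilon> n < d \<omega> n} \<le> p n" if "n0 \<le> n" for n
      using cheb[OF that, of "\<epsilon> n"] A that by (simp add: d_def p_def tail)
    \<comment> \<open>The summand \<open>i = 0\<close> of the finite \<open>K_const\<close> is
      \<open>a n0\<close> times the sum of all deviation bounds; as \<open>a n0\<close> is positive,
      that sum is finite, as Borel-Cantelli requires.\<close>
    have "(\<Sum>i. ennreal (a (n0 + i)) * (\<Sum>j. p (n0 + i + j))) < \<infinity>"
      using A by (simp add: K)
    from ennreal_suminf_lessD[OF this, of 0]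
    have "ennreal (a n0) * (\<Sum>j. p (n0 + j)) < \<infinity>"
      by simp
    moreover have "0 < a n0"
      using A by simp
    ultimately have "(\<Sum>j. p (n0 + j)) < \<infinity>"
      by (auto simp: ennreal_mult_less_top)
    from AE_limsup_le_1[OF sets le this] A
    show "AE \<omega> in M. limsup (\<lambda>n. ereal (norm (X n \<omega> - Xlim \<omega>) * inverse (\<epsilon> n))) \<le> 1"
      by (simp add: d_def)
    \<comment> \<open>All comparisons pass through the rank: \<open>E_O \<le> E_m\<close> and
      \<open>E_m \<le> K\<close> follow from it by transitivity under their respective conditions on
      \<open>n0\<close>.\<close>
    let ?E = "\<lambda>N. \<integral>\<^sup>+\<omega>. S_sum a n0 (N n0 \<epsilon> (d \<omega>)) \<partial>M"
    have "?E overlap_count \<le> ?E last_dev_rank"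
      by (intro nn_integral_mono S_sum_mono overlap_count_le_last_dev_rank)
    moreover have "?E last_dev_rank \<le> K_const n0 a \<epsilon> (incr_tail M X)"
      unfolding K by (rule nn_integral_S_sum_last_dev_rank_le[OF sets le])
    moreover have "?E last_dev_rank \<le> ?E last_dev" if "1 \<le> n0"
      using that by (intro nn_integral_mono S_sum_mono last_dev_rank_le_last_dev)
    moreover have "?E last_dev \<le> ?E last_dev_rank" if "n0 \<le> 1"
      using that by (intro nn_integral_mono S_sum_mono last_dev_le_last_dev_rank)
    ultimately show "let E_O = (\<integral>\<^sup>+\<omega>. S_sum a n0 (overlap_count n0 \<epsilon> (\<lambda>n. norm (X n \<omega> - Xlim \<omega>))) \<partial>M);
           E_m = (\<integral>\<^sup>+\<omega>. S_sum a n0 (last_dev n0 \<epsilon> (\<lambda>n. norm (X n \<omega> - Xlim \<omega>))) \<partial>M);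
           E_r = (\<integral>\<^sup>+\<omega>. S_sum a n0 (last_dev_rank n0 \<epsilon> (\<lambda>n. norm (X n \<omega> - Xlim \<omega>))) \<partial>M);
           K = K_const n0 a \<epsilon> (incr_tail M X)
       in E_O \<le> E_r \<and> E_r \<le> K \<and>
          (1 \<le> n0 \<longrightarrow> E_O \<le> E_m) \<and> (n0 \<le> 1 \<longrightarrow> E_m \<le> K)"
      unfolding Let_def d_def by (blast intro: order_trans)
  qed (rule Xlim_measurable Xlim_sq_moment_finite)+
qed

end
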